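(* Let $f\colon\mathbb{R}^d\to\mathbb{R}\cup\{+\infty\}$ be closed and $\mu$-strongly convex ($\mu>0$). Fix an iteration count $T\in\mathbb{N}$, a target accuracy $\epsilon>0$ and $p\in(0,1)$, and set $$\delta=\frac{\epsilon}{2+2T},\qquad \lambda_i=\mu 2^i\quad (i=0,\dots,T).$$ Then the point $x_{T+1}=\mathtt{proxBoost}(\delta,p,T)$ (defined in the context) satisfies $$\mathbb{P}\bigl(f(x_{T+1})-\min f\le\epsilon\bigr)\ge 1-(T+2)p.$$
   Context: $\mu$-strongly convex means $f-\frac{\mu}{2}\|\cdot\|^2$ is convex. $B_r(x)$ is the closed Euclidean ball. The procedure $\mathtt{proxBoost}(\delta,p,T)$, with penalties $\lambda_0,\dots,\lambda_T$, generates random points $x_0,\dots,x_{T+1}\in\mathbb{R}^d$ as follows. Set $\lambda_{-1}=0$ and $\varepsilon_j=\sqrt{\frac{2\delta}{\mu+\lambda_j}}$ for $j=-1,0,\dots,T-1$. Let $\bar x_0=\operatorname{argmin} f$, and for $i=0,\dots,T$ let $f^i(x)=f(x)+\frac{\lambda_i}{2}\|x-x_i\|^2$ and $\bar x_{i+1}=\operatorname{argmin} f^i$ (these depend on the random point $x_i$). For $j=0,\dots,T$ let $E_j$ be the event $\{x_i\in B_{\varepsilon_{i-1}}(\bar x_i)\text{ for all } i=0,\dots,j\}$. 1. $x_0$ is any random point with $\mathbb{P}[\|x_0-\bar x_0\|\le\varepsilon_{-1}]\ge 1-p$. 2. For $j=0,\dots,T-1$, $x_{j+1}$ is any random point with $\mathbb{P}[\|x_{j+1}-\bar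 x_{j+1}\|\le\varepsilon_j\mid E_j]\ge 1-p$. 3. $x_{T+1}$ is any random point with $\mathbb{P}[f^T(x_{T+1})-\min f^T\le\delta\mid E_T]\ge 1-p$. The output is $x_{T+1}$. The result is asserted for any points generated in accordance with these requirements. *)

theory Defs
  imports "HOL-Probability.Probability"
begin

text \<open>
  Functions into \<open>\<real> \<union> {+\<infinity>}\<close> are rendered as functions into \<^typ>\<open>ereal\<close> satisfying
  \<open>proper_fun\<close>, which rules out the value \<open>-\<infinity>\<close> and the function that is identically \<open>+\<infinity>\<close>
  (the latter has no minimizer in any meaningful sense).
\<close>

definition proper_fun :: "('a \<Rightarrow> ereal) \<Rightarrow> bool" where
  "proper_fun f \<longleftrightarrow> (\<forall>x. f x \<noteq> -\<infinity>) \<and> (\<exists>x. f x \<noteq> \<infinity>)"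

definition closed_fun :: "('a::topological_space \<Rightarrow> ereal) \<Rightarrow> bool" where
  "closed_fun f \<longleftrightarrow> closed {(x, r::real). f x \<le> ereal r}"

text \<open>
  The counterpart of \<^const>\<open>convex_on\<close> for extended values. For functions avoiding \<open>-\<infinity>\<close> the right-hand
  side never meets \<open>\<infinity> - \<infinity>\<close>; the convention \<open>0 * \<infinity> = 0\<close> makes the cases \<open>u = 0\<close>
  and \<open>v = 0\<close> trivial.
\<close>

definition convex_fun :: "('a::real_vector \<Rightarrow> ereal) \<Rightarrow> bool" where
  "convex_fun f \<longleftrightarrow>
    (\<forall>x y. \<forall>u\<ge>0. \<forall>v\<ge>0. u + v = 1 \<longrightarrow>
      f (u *\<^sub>R x + v *\<^sub>R y) \<le> ereal u * f x + ereal v * f y)"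

definition strongly_convex_fun :: "real \<Rightarrow> ('a::real_normed_vector \<Rightarrow> ereal) \<Rightarrow> bool" where
  "strongly_convex_fun \<mu> f \<longleftrightarrow> convex_fun (\<lambda>x. f x - ereal (\<mu> / 2 * (norm x)\<^sup>2))"

definition argmin :: "('a \<Rightarrow> ereal) \<Rightarrow> 'a" where
  "argmin f = (ARG_MIN f x. True)"

definition prox_fun :: "('a::real_normed_vector \<Rightarrow> ereal) \<Rightarrow> real \<Rightarrow> 'a \<Rightarrow> 'a \<Rightarrow> ereal" where
  "prox_fun f l z x = f x + ereal (l / 2 * (norm (x - z))\<^sup>2)"

text \<open>
  \<open>prox_center f lam x i \<omega>\<close> is the point \<open>\<xi>\<^sub>i\<close> with \<open>\<xi>\<^sub>0 = argmin f\<close> and \<open>\<xi>\<^sub>i\<^sub>+\<^sub>1 = argmin f\<^sup>i\<close>, where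
  \<open>f\<^sup>i = prox_fun f (lam i) (x i \<omega>)\<close> depends on the outcome \<open>\<omega>\<close> through the random point \<open>x i\<close>.
\<close>

fun prox_center ::
  "('a::real_normed_vector \<Rightarrow> ereal) \<Rightarrow> (nat \<Rightarrow> real) \<Rightarrow> (nat \<Rightarrow> 'w \<Rightarrow> 'a) \<Rightarrow> nat \<Rightarrow> 'w \<Rightarrow> 'a" where
  "prox_center f lam x 0 \<omega> = argmin f"
| "prox_center f lam x (Suc i) \<omega> = argmin (prox_fun f (lam i) (x i \<omega>))"

text \<open>The index \<open>j\<close> is an integer because it starts at \<open>-1\<close>, where the penalty is \<open>0\<close>.\<close>

definition prox_radius :: "real \<Rightarrow> real \<Rightarrow> (nat \<Rightarrow> real) \<Rightarrow> int \<Rightarrow> real" where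
  "prox_radius \<mu> \<delta> lam j = sqrt (2 * \<delta> / (\<mu> + (if j < 0 then 0 else lam (nat j))))"

definition prox_event ::
  "('a::real_normed_vector \<Rightarrow> ereal) \<Rightarrow> real \<Rightarrow> real \<Rightarrow> (nat \<Rightarrow> real) \<Rightarrow> (nat \<Rightarrow> 'w \<Rightarrow> 'a) \<Rightarrow> nat \<Rightarrow> 'w \<Rightarrow> bool"
where
  "prox_event f \<mu> \<delta> lam x j \<omega> \<longleftrightarrow>
    (\<forall>i\<le>j. x i \<omega> \<in> cball (prox_center f lam x i \<omega>) (prox_radius \<mu> \<delta> lam (int i - 1)))"

text \<open>
  \<open>proxBoost M f \<mu> lam \<delta> p T x\<close> says that the random points \<open>x 0, \<dots>, x (T + 1)\<close> on \<open>M\<close> are generated in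
  accordance with the procedure; its output is \<open>x (T + 1)\<close>. For \<open>p < 1\<close> the requirements
  force every conditioning event to have positive probability, so that the convention for
  \<^const>\<open>cond_prob\<close> on null events plays no role.
\<close>

definition proxBoost ::
  "'w measure \<Rightarrow> ('a::real_normed_vector \<Rightarrow> ereal) \<Rightarrow> real \<Rightarrow> (nat \<Rightarrow> real) \<Rightarrow> real \<Rightarrow> real \<Rightarrow> nat
    \<Rightarrow> (nat \<Rightarrow> 'w \<Rightarrow> 'a) \<Rightarrow> bool"
where
  "proxBoost M f \<mu> lam \<delta> p T x \<longleftrightarrow>
    (\<forall>i\<le>T + 1. x i \<in> borel_measurable M) \<and>
    \<P>(\<omega> in M. norm (x 0 \<omega> - prox_center f lam x 0 \<omega>) \<le> prox_radius \<mu> \<delta> lam (-1)) \<ge> 1 - p \<and>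
    (\<forall>j<T. \<P>(\<omega> in M. norm (x (j + 1) \<omega> - prox_center f lam x (j + 1) \<omega>) \<le> prox_radius \<mu> \<delta> lam (int j)
              \<bar> prox_event f \<mu> \<delta> lam x j \<omega>) \<ge> 1 - p) \<and>
    \<P>(\<omega> in M. prox_fun f (lam T) (x T \<omega>) (x (T + 1) \<omega>) - (INF y. prox_fun f (lam T) (x T \<omega>) y) \<le> ereal \<delta>
       \<bar> prox_event f \<mu> \<delta> lam x T \<omega>) \<ge> 1 - p"

end

theory Submission
  imports Defs
begin

text \<open>
  Let \<open>\<xi>\<^sub>i\<close> be the proximal centres and \<open>v\<^sub>j = min f\<^sup>j\<close>. On the event \<open>E\<^sub>T\<close> we have
  \<open>v\<^sub>0 \<le> f\<^sup>0 \<xi>\<^sub>0 \<le> min f + \<delta>\<close>, and testing \<open>f\<^sup>j\<^sup>+\<^sup>1\<close> at the minimizer \<open>\<xi>\<^sub>j\<^sub>+\<^sub>1\<close> of \<open>f\<^sup>j\<close> gives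
  \<open>v\<^sub>j\<^sub>+\<^sub>1 \<le> v\<^sub>j + \<lambda>\<^sub>j\<^sub>+\<^sub>1 \<delta> / (\<mu> + \<lambda>\<^sub>j) \<le> v\<^sub>j + 2\<delta>\<close>. Hence \<open>v\<^sub>T \<le> min f + (2T + 1)\<delta>\<close>, and a point that is
  \<open>\<delta>\<close>-optimal for \<open>f\<^sup>T\<close> is \<open>(2T + 2)\<delta>\<close>-optimal for \<open>f\<close>. Multiplying the conditional probabilities
  bounds the probability of success below by \<open>(1 - p)\<^sup>T\<^sup>+\<^sup>2\<close>, and Bernoulli's inequality applies.

  The events \<open>E\<^sub>j\<close> are measurable without any regularity of the proximal map: a non-measurable set
  has measure \<open>0\<close>, which the lower bounds \<open>1 - p > 0\<close> exclude.
\<close>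

section \<open>Closed functions and attained infima on compact sets\<close>

lemma closed_fun_sublevel:
  assumes "closed_fun f"
  shows "closed {x. f x \<le> ereal r}"
proof -
  have "closed ((\<lambda>x. (x, r)) -` {(x, r). f x \<le> ereal r})"
    using assms unfolding closed_fun_def
    by (intro closed_vimage continuous_intros) auto
  then show ?thesis by (simp add: vimage_def)
qed

text \<open>The epigraph of the sum is the preimage of that of \<open>f\<close> under the continuous
  map \<open>(x, r) \<mapsto> (x, r - c x)\<close>.\<close>

lemma closed_fun_add_continuous:
  fixes f :: "'a::topological_space \<Rightarrow> ereal" and c :: "'a \<Rightarrow> real"
  assumes "closed_fun f" and "continuous_on UNIV c"
  shows "closed_fun (\<lambda>x. f x + ereal (c x))"
proof -
  have "closed ((\<lambda>z. (fst z, snd z - c (fst z))) -` {(x, r). f x \<le> ereal r})"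
    using assms unfolding closed_fun_def
    by (intro closed_vimage continuous_intros continuous_on_compose2[OF assms(2)]) auto
  moreover have "f x + ereal (c x) \<le> ereal r \<longleftrightarrow> f x \<le> ereal (r - c x)" for x r
    by (cases "f x") auto
  ultimately show ?thesis
    unfolding closed_fun_def by (simp add: vimage_def case_prod_unfold)
qed

text \<open>Sublevel sets for levels above the infimum are closed and nested, so finitely many of
  them always meet inside \<open>K\<close>; compactness gives a common point.\<close>

lemma closed_fun_attains_inf:
  fixes f :: "'a::t2_space \<Rightarrow> ereal"
  assumes "closed_fun f" and "compact K" and "K \<noteq> {}"
  obtains x where "x \<in> K" and "\<And>y. y \<in> K \<Longrightarrow> f x \<le> f y"
proof -
  define I where "I = {r. (INF y\<in>K. f y) < ereal r}"
  have "K \<inter> (\<Inter>r\<in>I. {x. f x \<le> ereal r}) \<noteq> {}"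
  proof (rule compact_imp_fip_image[OF assms(2) closed_fun_sublevel[OF assms(1)]])
    fix J assume J: "finite J" "J \<subseteq> I"
    show "K \<inter> (\<Inter>r\<in>J. {x. f x \<le> ereal r}) \<noteq> {}"
    \<comment> \<open>The empty family has no \<open>Min\<close>; it is the only one when the
      infimum over \<open>K\<close> is \<infinity>.\<close>
    proof (cases "J = {}")
      case False
      then have "Min J \<in> I" using J Min_in by blast
      then obtain y where y: "y \<in> K" "f y < ereal (Min J)"
        unfolding I_def by (auto simp: INF_less_iff)
      have "f y \<le> ereal r" if "r \<in> J" for r
      proof -
        have "ereal (Min J) \<le> ereal r" using J that by simp
        then show ?thesis using y(2) by (simp add: order_trans[of _ "ereal (Min J)"])
      qed
      then show ?thesis using y(1) by blast
    qed (use assms(3) in simp)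
  qed
  then obtain x where x: "x \<in> K" "\<And>r. r \<in> I \<Longrightarrow> f x \<le> ereal r" by blast
  have "f x \<le> (INF y\<in>K. f y)"
  proof (rule ccontr)
    assume "\<not> f x \<le> (INF y\<in>K. f y)"
    then obtain r where "(INF y\<in>K. f y) < ereal r" "ereal r < f x"
      using ereal_dense2 by (metis not_le)
    then show False using x(2)[of r] unfolding I_def by simp
  qed
  then have "f x \<le> f y" if "y \<in> K" for y
    using that by (meson INF_lower order_trans)
  then show thesis using that x(1) by blast
qed

section \<open>Strong convexity and existence of minimizers\<close>

lemma strongly_convex_fun_combination:
  fixes f :: "'a::real_inner \<Rightarrow> ereal"
  assumes "strongly_convex_fun \<mu> f" and "f x = ereal a" and "f y = ereal b"
    and "0 \<le> u" and "0 \<le> v" and "u + v = 1"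
  shows "f (u *\<^sub>R x + v *\<^sub>R y) \<le> ereal (u * a + v * b - \<mu> / 2 * (u * v * (norm (y - x))\<^sup>2))"
proof -
  define z where "z = u *\<^sub>R x + v *\<^sub>R y"
  have u: "u = 1 - v" using assms by simp
  \<comment> \<open>This inner product identity, valid for \<open>u + v = 1\<close>, turns convexity
    of the shifted function into the quadratic gain.\<close>
  have norm_z: "(norm z)\<^sup>2 = u * (norm x)\<^sup>2 + v * (norm y)\<^sup>2 - u * v * (norm (y - x))\<^sup>2"
    unfolding z_def u power2_norm_eq_inner
    by (simp add: inner_simps inner_commute algebra_simps)
  have "f z - ereal (\<mu> / 2 * (norm z)\<^sup>2)
      \<le> ereal u * (f x - ereal (\<mu> / 2 * (norm x)\<^sup>2)) + ereal v * (f y - ereal (\<mu> / 2 * (norm y)\<^sup>2))"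
    using assms unfolding strongly_convex_fun_def convex_fun_def z_def by blast
  then have "f z \<le> ereal (u * (a - \<mu> / 2 * (norm x)\<^sup>2) + v * (b - \<mu> / 2 * (norm y)\<^sup>2)
      + \<mu> / 2 * (norm z)\<^sup>2)"
    by (cases "f z") (auto simp: assms(2,3))
  also have "u * (a - \<mu> / 2 * (norm x)\<^sup>2) + v * (b - \<mu> / 2 * (norm y)\<^sup>2) + \<mu> / 2 * (norm z)\<^sup>2
      = u * a + v * b - \<mu> / 2 * (u * v * (norm (y - x))\<^sup>2)"
    unfolding norm_z by (simp add: field_simps)
  finally show ?thesis unfolding z_def .
qed

text \<open>A finite lower bound on the unit ball about one point of finite value is enough: where a
  segment to a distant \<open>x\<close> leaves that ball, strong convexity would force
  \<open>f\<close> below the bound.\<close>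

lemma strongly_convex_fun_bounded_sublevel:
  fixes f :: "'a::euclidean_space \<Rightarrow> ereal"
  assumes "proper_fun f" and "closed_fun f" and "\<mu> > 0" and "strongly_convex_fun \<mu> f"
  shows "bounded {x. f x \<le> ereal r}"
proof -
  have not_MInf: "f x \<noteq> -\<infinity>" for x
    using assms(1) unfolding proper_fun_def by blast
  obtain w where "f w \<noteq> \<infinity>"
    using assms(1) unfolding proper_fun_def by blast
  then obtain a where a: "f w = ereal a"
    using not_MInf by (cases "f w") auto
  obtain q where q: "q \<in> cball w 1" "\<And>y. y \<in> cball w 1 \<Longrightarrow> f q \<le> f y"
    using closed_fun_attains_inf[OF assms(2), of "cball w 1"] by auto
  then have "f q \<le> ereal a" using a by (metis centre_in_cball zero_le_one)
  then obtain m where m: "f q = ereal m"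
    using not_MInf by (cases "f q") auto
  have "dist w x \<le> 1 + max 0 (2 * (\<bar>a\<bar> + \<bar>r\<bar> - m) / \<mu>)" if fx: "f x \<le> ereal r" for x
  proof (cases "dist w x \<le> 1")
    case False
    define t where "t = dist w x"
    have t: "t > 1" using False t_def by simp
    obtain b where b: "f x = ereal b" "b \<le> r"
      using fx not_MInf[of x] by (cases "f x") auto
    \<comment> \<open>as \<open>m \<le> f y\<close>, strong convexity on the segment from \<open>w\<close> to \<open>x\<close> limits its length \<open>t\<close>\<close>
    define y where "y = (1 - 1 / t) *\<^sub>R w + (1 / t) *\<^sub>R x"
    have "y - w = (1 / t) *\<^sub>R (x - w)"
      unfolding y_def by (simp add: algebra_simps)
    then have "norm (y - w) = norm (x - w) / t"
      using t by simp
    moreover have "norm (x - w) = t"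
      by (simp add: t_def dist_norm norm_minus_commute)
    ultimately have "dist w y = 1"
      using t by (simp add: dist_norm norm_minus_commute)
    then have "ereal m \<le> f y" using q m by auto
    also have "f y \<le> ereal ((1 - 1 / t) * a + (1 / t) * b
        - \<mu> / 2 * ((1 - 1 / t) * (1 / t) * (norm (x - w))\<^sup>2))"
      unfolding y_def using t by (intro strongly_convex_fun_combination assms a b) auto
    also have "norm (x - w) = t"
      by (simp add: t_def dist_norm norm_minus_commute)
    also have "(1 - 1 / t) * (1 / t) * t\<^sup>2 = t - 1"
      using t by (simp add: field_simps power2_eq_square)
    finally have "\<mu> / 2 * (t - 1) \<le> (1 - 1 / t) * a + (1 / t) * b - m"
      by (simp add: field_simps)
    moreover have "(1 - 1 / t) * a \<le> 1 * \<bar>a\<bar>"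
      using t by (intro order_trans[OF mult_left_mono mult_right_mono]) auto
    moreover have "(1 / t) * b \<le> 1 * \<bar>r\<bar>"
      using t b by (intro order_trans[OF mult_left_mono mult_right_mono]) auto
    ultimately have "\<mu> / 2 * (t - 1) \<le> 1 * \<bar>a\<bar> + 1 * \<bar>r\<bar> - m"
      by (meson add_mono diff_right_mono order_trans)
    then have "t - 1 \<le> 2 * (\<bar>a\<bar> + \<bar>r\<bar> - m) / \<mu>"
      using assms(3) by (simp add: field_simps)
    then show ?thesis unfolding t_def by simp
  qed auto
  then show ?thesis unfolding bounded_def by blast
qed

text \<open>A nonnegative penalty only raises values, so sublevel sets of the penalized function
  inherit boundedness from those of \<open>f\<close>. The case \<open>l = 0\<close> covers
  \<open>f\<close> itself.\<close>

lemma prox_fun_attains_inf: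
  fixes f :: "'a::euclidean_space \<Rightarrow> ereal"
  assumes "proper_fun f" and "closed_fun f" and "\<mu> > 0" and "strongly_convex_fun \<mu> f"
    and "0 \<le> l"
  obtains x where "\<And>y. prox_fun f l z x \<le> prox_fun f l z y"
proof -
  let ?h = "prox_fun f l z"
  have le: "f x \<le> ?h x" for x
    using assms(5) unfolding prox_fun_def by (cases "f x") auto
  have closed: "closed_fun ?h"
    using assms(2) unfolding prox_fun_def
    by (intro closed_fun_add_continuous continuous_intros) auto
  obtain w where "f w \<noteq> \<infinity>" "f w \<noteq> -\<infinity>"
    using assms(1) unfolding proper_fun_def by blast
  then obtain r where r: "?h w = ereal r"
    unfolding prox_fun_def by (cases "f w") auto
  have "bounded {x. ?h x \<le> ereal r}"
    by (rule bounded_subset[OF strongly_convex_fun_bounded_sublevel[OF assms(1-4), of r]])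
       (use le in \<open>auto intro: order_trans\<close>)
  then have "compact {x. ?h x \<le> ereal r}"
    using closed_fun_sublevel[OF closed] by (simp add: compact_eq_bounded_closed)
  moreover have "{x. ?h x \<le> ereal r} \<noteq> {}"
    using eq_refl[OF r] by blast
  ultimately obtain x where x: "x \<in> {x. ?h x \<le> ereal r}"
      "\<And>y. y \<in> {x. ?h x \<le> ereal r} \<Longrightarrow> ?h x \<le> ?h y"
    using closed_fun_attains_inf[OF closed] by metis
  have "?h x \<le> ?h y" for y
  proof (cases "?h y \<le> ereal r")
    case False
    then have "ereal r \<le> ?h y" by simp
    with x(1) show ?thesis by (simp add: order_trans[of _ "ereal r"])
  qed (simp add: x(2))
  then show thesis using that by blast
qed

text \<open>Finiteness keeps \<open>f y - (INF y. f y)\<close> clear of \<infinity> -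
  \<infinity>.\<close>

lemma strongly_convex_fun_finite_INF:
  fixes f :: "'a::euclidean_space \<Rightarrow> ereal"
  assumes "proper_fun f" and "closed_fun f" and "\<mu> > 0" and "strongly_convex_fun \<mu> f"
  obtains b where "(INF y. f y) = ereal b"
proof -
  have "prox_fun f 0 z = f" for z
    by (simp add: prox_fun_def fun_eq_iff flip: zero_ereal_def)
  then obtain w where w: "\<And>y. f w \<le> f y"
    using prox_fun_attains_inf[OF assms order_refl] by metis
  then have "(INF y. f y) = f w"
    by (intro antisym INF_lower INF_greatest) auto
  moreover have "f w \<noteq> \<infinity>" "f w \<noteq> -\<infinity>"
    using assms(1) w unfolding proper_fun_def by (metis ereal_infty_less_eq(1))+
  ultimately show thesis using that by (cases "f w") auto
qed

text \<open>\<open>ARG_MIN\<close> is a choice operator, so it can be trusted only once some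
  minimizer is known to exist.\<close>

lemma argmin_le:
  fixes f :: "'a \<Rightarrow> ereal"
  assumes "\<And>y. f x \<le> f y"
  shows "f (argmin f) \<le> f y"
proof -
  have "is_arg_min f (\<lambda>_. True) x"
    using assms by (auto simp: is_arg_min_def not_less)
  then have "is_arg_min f (\<lambda>_. True) (argmin f)"
    unfolding argmin_def arg_min_def by (rule someI)
  then show ?thesis by (auto simp: is_arg_min_def not_less)
qed

section \<open>Estimates along a fixed good outcome\<close>

lemma prox_radius_minus_one: "prox_radius \<mu> \<delta> lam (-1) = sqrt (2 * \<delta> / \<mu>)"
  by (simp add: prox_radius_def)

lemma prox_radius_int: "prox_radius \<mu> \<delta> lam (int j) = sqrt (2 * \<delta> / (\<mu> + lam j))"
  by (simp add: prox_radius_def)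

lemma prox_event_0:
  "prox_event f \<mu> \<delta> lam x 0 \<omega> \<longleftrightarrow>
    norm (x 0 \<omega> - prox_center f lam x 0 \<omega>) \<le> prox_radius \<mu> \<delta> lam (-1)"
  by (simp add: prox_event_def dist_norm norm_minus_commute)

lemma prox_event_Suc:
  "prox_event f \<mu> \<delta> lam x (Suc j) \<omega> \<longleftrightarrow>
    norm (x (Suc j) \<omega> - prox_center f lam x (Suc j) \<omega>) \<le> prox_radius \<mu> \<delta> lam (int j) \<and>
    prox_event f \<mu> \<delta> lam x j \<omega>"
  by (auto simp: prox_event_def dist_norm norm_minus_commute le_Suc_eq)

lemma proxBoost_success:
  fixes f :: "'a::euclidean_space \<Rightarrow> ereal"
  assumes "proper_fun f" and "closed_fun f" and "\<mu> > 0" and "strongly_convex_fun \<mu> f"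
    and "\<delta> \<ge> 0"
    and lam: "\<And>i. i \<le> T \<Longrightarrow> lam i = \<mu> * 2 ^ i"
    and event: "prox_event f \<mu> \<delta> lam x T \<omega>"
    and gap: "prox_fun f (lam T) (x T \<omega>) y - (INF y. prox_fun f (lam T) (x T \<omega>) y) \<le> ereal \<delta>"
  shows "f y - (INF y. f y) \<le> ereal ((2 + 2 * real T) * \<delta>)"
proof -
  define c where "c i = prox_center f lam x i \<omega>" for i
  define h where "h j = prox_fun f (lam j) (x j \<omega>)" for j
  have argmin: "prox_fun f l z (argmin (prox_fun f l z)) \<le> prox_fun f l z y" if "0 \<le> l" for l z y
    by (rule prox_fun_attains_inf[OF assms(1-4) that], rule argmin_le)
  have "prox_fun f 0 z = f" for z
    by (simp add: prox_fun_def fun_eq_iff flip: zero_ereal_def)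
  then have c_0: "f (c 0) \<le> f y" for y
    using argmin[of 0] by (simp add: c_def)
  have c_Suc: "h j (c (Suc j)) \<le> h j y" if "j \<le> T" for j y
    using argmin[of "lam j"] that assms(3) by (simp add: c_def h_def lam)
  have f_le_h: "f y \<le> h j y" if "j \<le> T" for j y
    using that assms(3) by (cases "f y") (auto simp: h_def prox_fun_def lam)
  have event_le: "prox_event f \<mu> \<delta> lam x j \<omega>" if "j \<le> T" for j
    using event that by (auto simp: prox_event_def)
  \<comment> \<open>Within radius \<open>sqrt (2 * \<delta> / d)\<close> of
    \<open>x j \<omega>\<close> the penalty is at most \<open>lam j * \<delta> / d\<close>. The
    chain takes \<open>d = \<mu>\<close>, \<open>s = \<delta>\<close> at its start and
    \<open>d = \<mu> + lam j\<close>, \<open>s = 2 * \<delta>\<close> for the penalty with index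
    \<open>Suc j\<close>.\<close>
  have test: "h j z \<le> f z + ereal s"
    if "j \<le> T" "norm (x j \<omega> - z) \<le> sqrt (2 * \<delta> / d)" "d > 0" "lam j * \<delta> \<le> s * d" for j z s d
  proof -
    have "(norm (z - x j \<omega>))\<^sup>2 \<le> (sqrt (2 * \<delta> / d))\<^sup>2"
      using that by (intro power_mono) (simp_all add: norm_minus_commute)
    also have "\<dots> = 2 * \<delta> / d"
      using that assms(5) by simp
    finally have "lam j / 2 * (norm (z - x j \<omega>))\<^sup>2 \<le> lam j / 2 * (2 * \<delta> / d)"
      using that(1) assms(3) by (intro mult_left_mono) (simp_all add: lam)
    also have "\<dots> \<le> s"
      using that by (simp add: field_simps)
    finally show ?thesis
      unfolding h_def prox_fun_def by (intro add_left_mono) simp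
  qed
  have bound: "h j (c (Suc j)) \<le> f (c 0) + ereal ((2 * real j + 1) * \<delta>)" if "j \<le> T" for j
    using that
  proof (induction j)
    case 0
    have "h 0 (c 0) \<le> f (c 0) + ereal \<delta>"
      using event_le[of 0] assms(3) unfolding prox_event_0 prox_radius_minus_one c_def
      by (intro test) (auto simp: lam)
    then show ?case using c_Suc[of 0 "c 0"] by simp
  next
    case (Suc j)
    \<comment> \<open>This is
      \<open>lam (Suc j) * \<delta> \<le> 2 * \<delta> * (\<mu> + lam j)\<close> written out: as the
      penalties only double, the loss per step does not grow with \<open>j\<close>.\<close>
    have "\<mu> * (2 * 2 ^ j * \<delta>) \<le> \<mu> * (2 * \<delta> * (1 + 2 ^ j))"
      using assms(3,5) by (intro mult_left_mono) (auto simp: field_simps)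
    then have "h (Suc j) (c (Suc j)) \<le> f (c (Suc j)) + ereal (2 * \<delta>)"
      using event_le[of "Suc j"] Suc.prems assms(3)
      unfolding prox_event_Suc prox_radius_int c_def
      by (intro test[where d = "\<mu> + lam j"]) (auto simp: lam field_simps add_pos_pos)
    also have "\<dots> \<le> h j (c (Suc j)) + ereal (2 * \<delta>)"
      using f_le_h[of j] Suc.prems by (intro add_right_mono) simp
    also have "\<dots> \<le> f (c 0) + ereal ((2 * real j + 1) * \<delta>) + ereal (2 * \<delta>)"
      using Suc by (intro add_right_mono) simp
    also have "\<dots> = f (c 0) + ereal ((2 * real (Suc j) + 1) * \<delta>)"
      by (simp add: add.assoc algebra_simps)
    finally show ?case using c_Suc[OF Suc.prems] by (meson order_trans)
  qed
  have INF_f: "(INF y. f y) = f (c 0)"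
    using c_0 by (intro antisym INF_lower INF_greatest) auto
  then obtain b where b: "f (c 0) = ereal b"
    using strongly_convex_fun_finite_INF[OF assms(1-4)] by metis
  have "(INF y. h T y) = h T (c (Suc T))"
    using c_Suc by (intro antisym INF_lower INF_greatest) auto
  \<comment> \<open>The minimum of \<open>h T\<close> is caught between \<open>b\<close> and the end
    of the chain, hence real, so that it can be cancelled in \<open>gap\<close>.\<close>
  moreover obtain v where v: "h T (c (Suc T)) = ereal v"
  proof -
    have "b \<le> h T (c (Suc T))"
      using b c_0 f_le_h[of T] by (metis order_refl order_trans)
    then show thesis using bound[of T] b that by (cases "h T (c (Suc T))") auto
  qed
  ultimately have "h T y - ereal v \<le> ereal \<delta>"
    using gap by (simp add: h_def)
  then have "f y \<le> ereal (v + \<delta>)"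
    using f_le_h[of T y] by (cases "h T y") (auto intro: order_trans simp: add.commute)
  also have "v + \<delta> \<le> b + (2 + 2 * real T) * \<delta>"
    using bound[of T] v b by (simp add: algebra_simps)
  finally show ?thesis
    using INF_f b by (cases "f y") auto
qed

section \<open>Chaining the conditional probabilities\<close>

lemma (in prob_space) cond_prob_ge_imp_joint:
  assumes "q > 0" and "\<P>(\<omega> in M. P \<omega> \<bar> Q \<omega>) \<ge> q"
  shows "{\<omega> \<in> space M. P \<omega> \<and> Q \<omega>} \<in> events"
    and "\<P>(\<omega> in M. P \<omega> \<and> Q \<omega>) \<ge> q * \<P>(\<omega> in M. Q \<omega>)"
proof -
  \<comment> \<open>Division by 0 gives 0, so a positive quotient makes both the joint probability
    and that of \<open>Q\<close> positive.\<close>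
  have pos: "\<P>(\<omega> in M. P \<omega> \<and> Q \<omega>) / \<P>(\<omega> in M. Q \<omega>) > 0"
    using assms unfolding cond_prob_def by linarith
  then show "{\<omega> \<in> space M. P \<omega> \<and> Q \<omega>} \<in> events"
    using measure_notin_sets by force
  have "\<P>(\<omega> in M. Q \<omega>) > 0"
    using pos by (simp add: zero_less_divide_iff zero_less_measure_iff)
  then show "\<P>(\<omega> in M. P \<omega> \<and> Q \<omega>) \<ge> q * \<P>(\<omega> in M. Q \<omega>)"
    using assms(2) unfolding cond_prob_def by (simp add: field_simps)
qed

theorem corollary3p3:
  fixes f :: "real ^ 'd \<Rightarrow> ereal"
    and \<mu> \<epsilon> p \<delta> :: real
    and T :: nat
    and lam :: "nat \<Rightarrow> real"
    and M :: "'w measure"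
    and x :: "nat \<Rightarrow> 'w \<Rightarrow> real ^ 'd"
  assumes "proper_fun f" and "closed_fun f" and "\<mu> > 0" and "strongly_convex_fun \<mu> f"
    and "\<epsilon> > 0" and "0 < p" and "p < 1"
    and "\<delta> = \<epsilon> / (2 + 2 * real T)"
    and "\<And>i. i \<le> T \<Longrightarrow> lam i = \<mu> * 2 ^ i"
    and "prob_space M"
    and "proxBoost M f \<mu> lam \<delta> p T x"
  shows "\<P>(\<omega> in M. f (x (T + 1) \<omega>) - (INF y. f y) \<le> ereal \<epsilon>) \<ge> 1 - (real T + 2) * p"
proof -
  interpret prob_space M by fact
  let ?E = "prox_event f \<mu> \<delta> lam x"
  let ?gap = "\<lambda>\<omega>. prox_fun f (lam T) (x T \<omega>) (x (T + 1) \<omega>)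
    - (INF y. prox_fun f (lam T) (x T \<omega>) y) \<le> ereal \<delta>"
  let ?good = "{\<omega> \<in> space M. f (x (T + 1) \<omega>) - (INF y. f y) \<le> ereal \<epsilon>}"
  have meas: "x (T + 1) \<in> borel_measurable M"
    and start: "\<P>(\<omega> in M. ?E 0 \<omega>) \<ge> 1 - p"
    and step: "\<And>j. j < T \<Longrightarrow> \<P>(\<omega> in M. norm (x (Suc j) \<omega> - prox_center f lam x (Suc j) \<omega>)
        \<le> prox_radius \<mu> \<delta> lam (int j) \<bar> ?E j \<omega>) \<ge> 1 - p"
    and final: "\<P>(\<omega> in M. ?gap \<omega> \<bar> ?E T \<omega>) \<ge> 1 - p"
    using assms(11) unfolding proxBoost_def prox_event_0 by auto
  have \<delta>: "\<delta> \<ge> 0"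
    using assms(5,8) by simp
  have \<epsilon>: "(2 + 2 * real T) * \<delta> = \<epsilon>"
    unfolding assms(8) by (simp add: add_pos_nonneg less_imp_neq[symmetric])

  \<comment> \<open>The exponent counts the \<open>j + 1\<close> points
    \<open>x 0, ..., x j\<close>; the output adds one more factor.\<close>
  have "\<P>(\<omega> in M. ?E j \<omega>) \<ge> (1 - p) ^ (j + 1)" if "j \<le> T" for j
    using that
  proof (induction j)
    case 0
    then show ?case using start by simp
  next
    case (Suc j)
    have "(1 - p) * (1 - p) ^ (j + 1) \<le> (1 - p) * \<P>(\<omega> in M. ?E j \<omega>)"
      using Suc assms(7) by (intro mult_left_mono) auto
    also have "\<dots> \<le> \<P>(\<omega> in M. ?E (Suc j) \<omega>)"
      unfolding prox_event_Suc using Suc.prems assms(7)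
      by (intro cond_prob_ge_imp_joint(2) step) auto
    finally show ?case by simp
  qed
  then have "(1 - p) * (1 - p) ^ (T + 1) \<le> (1 - p) * \<P>(\<omega> in M. ?E T \<omega>)"
    using assms(7) by (intro mult_left_mono) auto
  also have "\<dots> \<le> \<P>(\<omega> in M. ?gap \<omega> \<and> ?E T \<omega>)"
    using assms(7) by (intro cond_prob_ge_imp_joint(2) final) auto
  also have "\<dots> \<le> prob ?good"
  proof (rule finite_measure_mono)
    show "{\<omega> \<in> space M. ?gap \<omega> \<and> ?E T \<omega>} \<subseteq> ?good"
      using proxBoost_success[OF assms(1-4) \<delta> assms(9), of T x] unfolding \<epsilon> by blast
    \<comment> \<open>Monotonicity needs the larger set measurable. Subtracting the finite infimum
      is a continuous shift, so the sublevel set is closed, hence Borel.\<close>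
    obtain b where "(INF y. f y) = ereal b"
      using strongly_convex_fun_finite_INF[OF assms(1-4)] .
    then have "closed_fun (\<lambda>y. f y - (INF y. f y))"
      using closed_fun_add_continuous[OF assms(2), of "\<lambda>_. - b"] by (simp add: minus_ereal_def)
    then have "x (T + 1) -` {y. f y - (INF y. f y) \<le> ereal \<epsilon>} \<inter> space M \<in> events"
      by (intro measurable_sets[OF meas] borel_closed closed_fun_sublevel)
    also have "x (T + 1) -` {y. f y - (INF y. f y) \<le> ereal \<epsilon>} \<inter> space M = ?good"
      by auto
    finally show "?good \<in> events" .
  qed
  finally have "(1 - p) ^ (T + 2) \<le> prob ?good" by simp
  moreover have "1 + real (T + 2) * (- p) \<le> (1 + (- p)) ^ (T + 2)"
    using assms(7) by (intro Bernoulli_inequality) simp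
  ultimately show ?thesis by (simp add: algebra_simps)
qed

end
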